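(* Let $X$ be a nonempty set. (a) Let $t,t'\in \mathrm{ST}(X)$. Then $t=_E t'$ implies $t=_{\mathrm{AC}}t'$. (b) Let $t,t'\in \mathrm{PT}(X)$. Then $t=_{E_{\mathrm{rd}}}t'$ implies $t=_{\mathrm{AC}}t'$. (c) Let $t,t'\in \mathrm{PT}_{\mathrm{id}}(X)$. Then $t=_{E_{\mathrm{id,rd}}}t'$ implies $t=_{\mathrm{AC}}t'$.
   Context: $\mathrm{T}(X)$ is the set (and term algebra) of all terms built from elements of $X$, constants $\hat 0,\hat 1$, and binary symbols $\hat+,\hat\times$ (infix). $=_E$ is the smallest congruence on the term algebra $\mathrm{T}(X)$ containing, for all $a,b,c\in \mathrm{T}(X)$, the pairs $(a\hat+(b\hat+c),(a\hat+b)\hat+c)$, $(a\hat+b,b\hat+a)$, $(a\hat+\hat0,a)$, $(a\hat\times(b\hat\times c),(a\hat\times b)\hat\times c)$, $(\hat1\hat\times a,a)$, $(a\hat\times\hat1,a)$, $(a\hat\times\hat0,\hat0)$, $(\hat0\hat\times a,\hat0)$. $=_{E_{\mathrm{rd}}}$ is the smallest congruence containing these pairs and all $((a\hat+b)\hat\times c,(a\hat\times c)\hat+(b\hat\times c))$. $=_{E_{\mathrm{id,rd}}}$ is the smallest congruence containing all the previous pairs and all $(a\hat+a,a)$. A term $s$ is simple if $s=\hat 0$, or $s$ contains neither $\hat 0$ nor any subterm of the form $\hat 1\hat\times s'$ or $s'\hat\times\hat 1$. $\mathrm{ST}(X)$ is the set of simple terms. For $s,t\in \mathrm{ST}(X)$,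 $s=_{\mathrm{AC}}t$ means that $t$ is obtained from $s$ by finitely many steps, each replacing a subterm occurrence using, in either direction, one of: $a\hat+(b\hat+c)\leftrightarrow(a\hat+b)\hat+c$, $a\hat+b\leftrightarrow b\hat+a$, $a\hat\times(b\hat\times c)\leftrightarrow(a\hat\times b)\hat\times c$ (such steps preserve simplicity). A monomial term is a term built from elements of $X$ using only $\hat\times$. The set $\mathrm{PT}(X)$ of polynomial terms is the smallest $U\subseteq \mathrm{ST}(X)$ with: (a) $\hat 0,\hat 1$ and all monomial terms are in $U$; (b) if $s,t\in U\setminus\{\hat 0\}$ then $s\hat+t\in U$; (c) if $s$ is a monomial term and $t\in U\setminus\{\hat 0,\hat 1\}$ then $s\hat\times t\in U$. A sum term is a simple term $s_1\hat+s_2$ with $s_1,s_2\in \mathrm{ST}(X)\setminus\{\hat 0\}$; a product term is a simple term $s_1\hat\times s_2$ with $s_1,s_2\in \mathrm{ST}(X)\setminus\{\hat0,\hat1\}$. Each sum term is, up to omitted parentheses, uniquely $t_1\hat+\cdots\hat+t_n$ ($n\ge2$) with every $t_i$ a product term or in $X\cup\{\hat 1\}$ (its sum-product decomposition). $\mathrm{ST}_{\mathrm{id}}(X)$ is the smallest $U\subseteq \mathrm{ST}(X)$ with: (a) $\hat0,\hat1$ and all monomial terms are in $U$; (b) if $t$ is a sum term with sum-product decomposition $t_1\hat+\cdots\hat+t_n$, all $t_i\in U$, and $t_i\neq_{\mathrm{AC}}t_j$ for $i<j$, then $t\in U$; (c) if $s,t\in U\setminus\{\hat0,\hat1\}$ then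 $s\hat\times t\in U$. $\mathrm{PT}_{\mathrm{id}}(X)=\mathrm{PT}(X)\cap \mathrm{ST}_{\mathrm{id}}(X)$. *)

theory Defs
  imports Main
begin

datatype (vars: 'x) trm =
    Var 'x
  | Zero
  | One
  | Add "'x trm" "'x trm"  (infixl "\<oplus>" 65)
  | Mul "'x trm" "'x trm"  (infixl "\<otimes>" 70)

definition T :: "'x set \<Rightarrow> 'x trm set" where
  "T X = {t. vars t \<subseteq> X}"


definition congruence :: "'x set \<Rightarrow> 'x trm rel \<Rightarrow> bool" where
  "congruence X R \<longleftrightarrow> equiv (T X) R \<and>
     (\<forall>a a' b b'. (a, a') \<in> R \<longrightarrow> (b, b') \<in> R \<longrightarrow>
        (a \<oplus> b, a' \<oplus> b') \<in> R \<and> (a \<otimes> b, a' \<otimes> b') \<in> R)"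

definition smallest_congruence :: "'x set \<Rightarrow> 'x trm rel \<Rightarrow> 'x trm rel" where
  "smallest_congruence X P = \<Inter>{R. congruence X R \<and> P \<subseteq> R}"

definition E :: "'x set \<Rightarrow> 'x trm rel" where
  "E X =
     {(a \<oplus> (b \<oplus> c), (a \<oplus> b) \<oplus> c) | a b c. a \<in> T X \<and> b \<in> T X \<and> c \<in> T X} \<union>
     {(a \<oplus> b, b \<oplus> a) | a b. a \<in> T X \<and> b \<in> T X} \<union>
     {(a \<oplus> Zero, a) | a. a \<in> T X} \<union>
     {(a \<otimes> (b \<otimes> c), (a \<otimes> b) \<otimes> c) | a b c. a \<in> T X \<and> b \<in> T X \<and> c \<in> T X} \<union>
     {(One \<otimes> a, a) | a. a \<in> T X} \<union>
     {(a \<otimes> One, a) | a. a \<in> T X} \<union>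
     {(a \<otimes> Zero, Zero) | a. a \<in> T X} \<union>
     {(Zero \<otimes> a, Zero) | a. a \<in> T X}"

definition E_rd :: "'x set \<Rightarrow> 'x trm rel" where
  "E_rd X = E X \<union>
     {((a \<oplus> b) \<otimes> c, (a \<otimes> c) \<oplus> (b \<otimes> c)) | a b c. a \<in> T X \<and> b \<in> T X \<and> c \<in> T X}"

definition E_id_rd :: "'x set \<Rightarrow> 'x trm rel" where
  "E_id_rd X = E_rd X \<union> {(a \<oplus> a, a) | a. a \<in> T X}"

definition eq_E :: "'x set \<Rightarrow> 'x trm rel" where
  "eq_E X = smallest_congruence X (E X)"

definition eq_E_rd :: "'x set \<Rightarrow> 'x trm rel" where
  "eq_E_rd X = smallest_congruence X (E_rd X)"

definition eq_E_id_rd :: "'x set \<Rightarrow> 'x trm rel" where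
  "eq_E_id_rd X = smallest_congruence X (E_id_rd X)"


fun subterms :: "'x trm \<Rightarrow> 'x trm set" where
  "subterms (s \<oplus> t) = insert (s \<oplus> t) (subterms s \<union> subterms t)"
| "subterms (s \<otimes> t) = insert (s \<otimes> t) (subterms s \<union> subterms t)"
| "subterms t = {t}"

definition simple :: "'x trm \<Rightarrow> bool" where
  "simple s \<longleftrightarrow> s = Zero \<or>
     (Zero \<notin> subterms s \<and> (\<forall>s'. One \<otimes> s' \<notin> subterms s \<and> s' \<otimes> One \<notin> subterms s))"

definition ST :: "'x set \<Rightarrow> 'x trm set" where
  "ST X = {s \<in> T X. simple s}"


inductive ac_step :: "'x trm \<Rightarrow> 'x trm \<Rightarrow> bool" where
  add_assoc: "ac_step (a \<oplus> (b \<oplus> c)) ((a \<oplus> b) \<oplus> c)"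
| add_comm: "ac_step (a \<oplus> b) (b \<oplus> a)"
| mul_assoc: "ac_step (a \<otimes> (b \<otimes> c)) ((a \<otimes> b) \<otimes> c)"
| add_left: "ac_step s s' \<Longrightarrow> ac_step (s \<oplus> t) (s' \<oplus> t)"
| add_right: "ac_step t t' \<Longrightarrow> ac_step (s \<oplus> t) (s \<oplus> t')"
| mul_left: "ac_step s s' \<Longrightarrow> ac_step (s \<otimes> t) (s' \<otimes> t)"
| mul_right: "ac_step t t' \<Longrightarrow> ac_step (s \<otimes> t) (s \<otimes> t')"

text \<open>The relation is defined on all terms. Started from a term in \<open>ST X\<close> it stays in
  \<open>ST X\<close> (lemma \<open>eq_AC_ST\<close> below), so its restriction to simple terms needs no
  further side condition.\<close>

definition eq_AC :: "'x trm \<Rightarrow> 'x trm \<Rightarrow> bool"  (infix "=\<^sub>A\<^sub>C" 50) where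
  "s =\<^sub>A\<^sub>C t \<longleftrightarrow> (symclp ac_step)\<^sup>*\<^sup>* s t"


inductive_set monomial_terms :: "'x set \<Rightarrow> 'x trm set" for X where
  "x \<in> X \<Longrightarrow> Var x \<in> monomial_terms X"
| "s \<in> monomial_terms X \<Longrightarrow> t \<in> monomial_terms X \<Longrightarrow> s \<otimes> t \<in> monomial_terms X"

text \<open>The inclusions of \<open>PT X\<close> and, further down, \<open>ST_id X\<close> in \<open>ST X\<close> are not part of
  the inductive definitions; they are the lemmas \<open>PT_subset_ST\<close> and \<open>ST_id_subset_ST\<close>.\<close>

inductive_set PT :: "'x set \<Rightarrow> 'x trm set" for X where
  zero: "Zero \<in> PT X"
| one: "One \<in> PT X"
| monomial: "s \<in> monomial_terms X \<Longrightarrow> s \<in> PT X"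
| add: "s \<in> PT X \<Longrightarrow> s \<noteq> Zero \<Longrightarrow> t \<in> PT X \<Longrightarrow> t \<noteq> Zero \<Longrightarrow> s \<oplus> t \<in> PT X"
| mul: "s \<in> monomial_terms X \<Longrightarrow> t \<in> PT X \<Longrightarrow> t \<notin> {Zero, One} \<Longrightarrow> s \<otimes> t \<in> PT X"

definition sum_terms :: "'x set \<Rightarrow> 'x trm set" where
  "sum_terms X = ST X \<inter> {s\<^sub>1 \<oplus> s\<^sub>2 | s\<^sub>1 s\<^sub>2. s\<^sub>1 \<in> ST X - {Zero} \<and> s\<^sub>2 \<in> ST X - {Zero}}"

definition product_terms :: "'x set \<Rightarrow> 'x trm set" where
  "product_terms X =
     ST X \<inter> {s\<^sub>1 \<otimes> s\<^sub>2 | s\<^sub>1 s\<^sub>2. s\<^sub>1 \<in> ST X - {Zero, One} \<and> s\<^sub>2 \<in> ST X - {Zero, One}}"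

text \<open>\<open>bracketing ts t\<close>: \<open>t\<close> arises from the sum of the list \<open>ts\<close>, in the given order, by
  some choice of parentheses.\<close>

inductive bracketing :: "'x trm list \<Rightarrow> 'x trm \<Rightarrow> bool" where
  single: "bracketing [t] t"
| add: "bracketing ss s \<Longrightarrow> bracketing ts t \<Longrightarrow> bracketing (ss @ ts) (s \<oplus> t)"

definition sum_product_decomposition :: "'x set \<Rightarrow> 'x trm \<Rightarrow> 'x trm list \<Rightarrow> bool" where
  "sum_product_decomposition X t ts \<longleftrightarrow>
     t \<in> sum_terms X \<and> bracketing ts t \<and> length ts \<ge> 2 \<and>
     set ts \<subseteq> product_terms X \<union> Var ` X \<union> {One}"

inductive_set ST_id :: "'x set \<Rightarrow> 'x trm set" for X where
  zero: "Zero \<in> ST_id X"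
| one: "One \<in> ST_id X"
| monomial: "s \<in> monomial_terms X \<Longrightarrow> s \<in> ST_id X"
| sum: "sum_product_decomposition X t ts \<Longrightarrow> \<forall>u \<in> set ts. u \<in> ST_id X \<Longrightarrow>
    \<forall>i j. i < j \<and> j < length ts \<longrightarrow> \<not> ts ! i =\<^sub>A\<^sub>C ts ! j \<Longrightarrow> t \<in> ST_id X"
| mul: "s \<in> ST_id X \<Longrightarrow> s \<notin> {Zero, One} \<Longrightarrow>
    t \<in> ST_id X \<Longrightarrow> t \<notin> {Zero, One} \<Longrightarrow> s \<otimes> t \<in> ST_id X"

definition PT_id :: "'x set \<Rightarrow> 'x trm set" where
  "PT_id X = PT X \<inter> ST_id X"


lemma subterms_self: "t \<in> subterms t"
  by (cases t) auto

lemma simple_Add: "simple (s \<oplus> t) \<longleftrightarrow> simple s \<and> simple t \<and> s \<noteq> Zero \<and> t \<noteq> Zero"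
  using subterms_self[of s] subterms_self[of t] by (auto simp: simple_def)

lemma simple_Mul:
  "simple (s \<otimes> t) \<longleftrightarrow> simple s \<and> simple t \<and> s \<notin> {Zero, One} \<and> t \<notin> {Zero, One}"
  using subterms_self[of s] subterms_self[of t] by (auto simp: simple_def)

lemma simple_atom: "simple (Var x)" "simple Zero" "simple One"
  by (auto simp: simple_def)

lemma ac_step_atom:
  assumes "ac_step s t"
  shows "s \<noteq> Zero \<and> s \<noteq> One \<and> t \<noteq> Zero \<and> t \<noteq> One"
  using assms by cases auto

lemma ac_step_simple: "ac_step s t \<Longrightarrow> simple s \<longleftrightarrow> simple t"
  by (induction rule: ac_step.induct)
    (auto simp: simple_Add simple_Mul dest: ac_step_atom)

lemma ac_step_vars: "ac_step s t \<Longrightarrow> vars s = vars t"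
  by (induction rule: ac_step.induct) auto

lemma eq_AC_ST:
  assumes "s =\<^sub>A\<^sub>C t" shows "s \<in> ST X \<longleftrightarrow> t \<in> ST X"
  using assms unfolding eq_AC_def
  by (induction rule: rtranclp_induct)
    (auto simp: ST_def T_def elim!: symclpE dest: ac_step_simple ac_step_vars)

lemma monomial_terms_subset_ST: "monomial_terms X \<subseteq> ST X - {Zero, One}"
proof
  fix s assume "s \<in> monomial_terms X"
  then show "s \<in> ST X - {Zero, One}"
    by induction (auto simp: ST_def T_def simple_atom simple_Mul)
qed

lemma PT_subset_ST: "PT X \<subseteq> ST X"
proof
  fix s assume "s \<in> PT X"
  then show "s \<in> ST X"
    by induction
      (use monomial_terms_subset_ST in \<open>fastforce simp: ST_def T_def simple_atom simple_Add simple_Mul\<close>)+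
qed

lemma ST_id_subset_ST: "ST_id X \<subseteq> ST X"
proof
  fix s assume "s \<in> ST_id X"
  then show "s \<in> ST X"
  proof induction
    case (sum t ts)
    then show ?case by (simp add: sum_product_decomposition_def sum_terms_def)
  qed (use monomial_terms_subset_ST in \<open>fastforce simp: ST_def T_def simple_atom simple_Mul\<close>)+
qed

lemma bracketing_not_Nil: "bracketing ts t \<Longrightarrow> ts \<noteq> []"
  by (induction rule: bracketing.induct) auto

lemma bracketing_unique:
  assumes "bracketing ts t" "bracketing us t"
    and "\<And>u v. u \<oplus> v \<notin> set ts" "\<And>u v. u \<oplus> v \<notin> set us"
  shows "ts = us"
  using assms
proof (induction arbitrary: us rule: bracketing.induct)
  case (single t)
  from single.prems(1) show ?case
  proof cases
    case (add ss s ts u)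
    then have "s \<oplus> u \<in> set [t]" by simp
    with single.prems(2) show ?thesis by blast
  qed simp
next
  case (add ss s ts t)
  from add.prems(1) show ?case
  proof cases
    case single
    then have "s \<oplus> t \<in> set us" by simp
    with add.prems(3) show ?thesis by blast
  next
    case split: (add ss' ts')
    have "ss = ss'"
    proof (rule add.IH(1))
      show "bracketing ss' s" by fact
      show "u \<oplus> v \<notin> set ss" for u v using add.prems(2)[of u v] by simp
      show "u \<oplus> v \<notin> set ss'" for u v using add.prems(3)[of u v] split(1) by simp
    qed
    moreover have "ts = ts'"
    proof (rule add.IH(2))
      show "bracketing ts' t" by fact
      show "u \<oplus> v \<notin> set ts" for u v using add.prems(2)[of u v] by simp
      show "u \<oplus> v \<notin> set ts'" for u v using add.prems(3)[of u v] split(1) by simp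
    qed
    ultimately show ?thesis using split(1) by simp
  qed
qed

lemma bracketing_exists:
  assumes "t \<in> ST X - {Zero}"
  shows "\<exists>ts. bracketing ts t \<and> set ts \<subseteq> product_terms X \<union> Var ` X \<union> {One}"
  using assms
proof (induction t)
  case (Add s t)
  then obtain ss ts where
    "bracketing ss s" "set ss \<subseteq> product_terms X \<union> Var ` X \<union> {One}"
    "bracketing ts t" "set ts \<subseteq> product_terms X \<union> Var ` X \<union> {One}"
    by (auto simp: ST_def T_def simple_Add)
  then show ?case
    by (intro exI[of _ "ss @ ts"]) (auto intro: bracketing.add)
next
  case (Mul s t)
  then show ?case
    by (intro exI[of _ "[s \<otimes> t]"])
      (auto simp: product_terms_def ST_def T_def simple_Mul intro: bracketing.single)
next
  case (Var x)
  then show ?case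
    by (intro exI[of _ "[Var x]"]) (auto simp: ST_def T_def intro: bracketing.single)
next
  case One
  then show ?case
    by (intro exI[of _ "[One]"]) (auto intro: bracketing.single)
qed auto

lemma sum_product_decomposition_ex1:
  assumes "t \<in> sum_terms X"
  shows "\<exists>!ts. sum_product_decomposition X t ts"
proof (rule ex_ex1I)
  from assms obtain s1 s2 where t: "t = s1 \<oplus> s2" "t \<in> ST X - {Zero}"
    by (auto simp: sum_terms_def)
  then obtain ts where ts: "bracketing ts t" "set ts \<subseteq> product_terms X \<union> Var ` X \<union> {One}"
    using bracketing_exists by blast
  from ts(1) have "length ts \<ge> 2"
  proof cases
    case single
    then show ?thesis using ts(2) t(1) by (auto simp: product_terms_def)
  next
    case (add ss s us u)
    then have "ss \<noteq> []" "us \<noteq> []" by (auto dest: bracketing_not_Nil)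
    then show ?thesis using add by (cases ss; cases us) auto
  qed
  with assms ts show "\<exists>ts. sum_product_decomposition X t ts"
    by (auto simp: sum_product_decomposition_def)
next
  fix ts us
  assume "sum_product_decomposition X t ts" "sum_product_decomposition X t us"
  then show "ts = us"
    by (auto simp: sum_product_decomposition_def product_terms_def intro!: bracketing_unique[of ts t us])
qed

end

theory Submission
  imports Defs "HOL-Library.Multiset"
begin

text \<open>
  All three parts follow one pattern: an equation derivable from a set of axioms holds in every
  model of these axioms, so it suffices to find a model in which terms of the given normal form
  are equal only if they agree up to AC.

  For the first part the model consists of the simple terms modulo AC, with operations
  \<open>sadd\<close> and \<open>smul\<close> that apply the laws for \<open>Zero\<close> and \<open>One\<close> on the fly.
  The evaluation \<open>simplify\<close> fixes simple terms.

  For the other two parts, recall that the self-maps of a commutative monoid form a structure in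
  which right distributivity \<open>(f + g) \<circ> h = f \<circ> h + g \<circ> h\<close> holds by definition, whereas
  left distributivity does not. If all maps fix \<open>0\<close>, then the remaining axioms hold as well.
  The monoid used here consists of finite multisets of trees, where a tree
  is either the unit or a variable that multiplies a multiset of trees; a variable \<open>x\<close> maps a
  nonempty multiset \<open>A\<close> to the singleton \<open>{x A}\<close>, and fixes the empty one. A polynomial term is recovered up to AC from the image of the
  multiset \<open>{1}\<close> under its action (relation \<open>reads\<close>, lemma \<open>reads_unique\<close>), which proves
  the second part.

  For the third part the sum of multisets is replaced by their union, which is idempotent.
  A term in \<open>PT_id\<close> never adds two summands that are equal up to AC, so by
  the second part it only ever joins disjoint multisets, for which sum and union agree
  (\<open>act_union_eq_act_plus\<close>). Hence the third part reduces to the second.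
\<close>

section \<open>Congruences and AC-equality\<close>

lemma smallest_congruence_least:
  assumes "equivp Q"
    and "\<And>a a' b b'. Q a a' \<Longrightarrow> Q b b' \<Longrightarrow> Q (a \<oplus> b) (a' \<oplus> b') \<and> Q (a \<otimes> b) (a' \<otimes> b')"
    and P: "\<And>s t. (s, t) \<in> P \<Longrightarrow> s \<in> T X \<and> t \<in> T X \<and> Q s t"
    and "(s, t) \<in> smallest_congruence X P"
  shows "Q s t"
proof -
  let ?R = "{(s, t). s \<in> T X \<and> t \<in> T X \<and> Q s t}"
  have "equiv (T X) ?R"
    using assms(1)
    by (intro equivI refl_onI symI transI)
      (auto intro: equivp_reflp equivp_symp equivp_transp)
  moreover have "a \<oplus> b \<in> T X \<and> a \<otimes> b \<in> T X" if "a \<in> T X" "b \<in> T X" for a b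
    using that by (simp add: T_def)
  ultimately have "congruence X ?R"
    unfolding congruence_def using assms(2) by auto
  moreover have "P \<subseteq> ?R" using P by auto
  ultimately have "smallest_congruence X P \<subseteq> ?R"
    unfolding smallest_congruence_def by blast
  with assms(4) show ?thesis by blast
qed

lemma E_id_rd_subset_T: "(s, t) \<in> E_id_rd X \<Longrightarrow> s \<in> T X \<and> t \<in> T X"
  by (auto simp: E_id_rd_def E_rd_def E_def T_def)

lemma eq_AC_equivp: "equivp (=\<^sub>A\<^sub>C)"
  by (intro equivpI reflpI sympI transpI)
    (auto simp: eq_AC_def intro: sympD[OF symp_rtranclp_symclp])

lemma eq_AC_refl [simp]: "s =\<^sub>A\<^sub>C s"
  and eq_AC_sym: "s =\<^sub>A\<^sub>C t \<Longrightarrow> t =\<^sub>A\<^sub>C s"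
  and eq_AC_trans [trans]: "s =\<^sub>A\<^sub>C t \<Longrightarrow> t =\<^sub>A\<^sub>C u \<Longrightarrow> s =\<^sub>A\<^sub>C u"
  using eq_AC_equivp by (blast intro: equivp_reflp equivp_symp equivp_transp)+

lemma ac_step_eq_AC: "ac_step s t \<Longrightarrow> s =\<^sub>A\<^sub>C t"
  by (auto simp: eq_AC_def intro: symclpI)

lemma eq_AC_add_comm: "s \<oplus> t =\<^sub>A\<^sub>C t \<oplus> s"
  and eq_AC_add_assoc: "s \<oplus> (t \<oplus> u) =\<^sub>A\<^sub>C s \<oplus> t \<oplus> u"
  and eq_AC_mul_assoc: "s \<otimes> (t \<otimes> u) =\<^sub>A\<^sub>C s \<otimes> t \<otimes> u"
  by (blast intro: ac_step_eq_AC ac_step.intros)+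

lemma eq_AC_context:
  assumes "s =\<^sub>A\<^sub>C t" and "\<And>s t. ac_step s t \<Longrightarrow> ac_step (f s) (f t)"
  shows "f s =\<^sub>A\<^sub>C f t"
  using assms(1) unfolding eq_AC_def
proof (induction rule: rtranclp_induct)
  case (step u v)
  then have "symclp ac_step (f u) (f v)" using assms(2) by (auto simp: symclp_def)
  with step.IH show ?case by simp
qed simp

lemma eq_AC_add_cong: "s =\<^sub>A\<^sub>C s' \<Longrightarrow> t =\<^sub>A\<^sub>C t' \<Longrightarrow> s \<oplus> t =\<^sub>A\<^sub>C s' \<oplus> t'"
  by (rule eq_AC_trans[OF eq_AC_context[of s s' "\<lambda>s. s \<oplus> t"] eq_AC_context[of t t' "\<lambda>t. s' \<oplus> t"]])
    (auto intro: ac_step.intros)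

lemma eq_AC_mul_cong: "s =\<^sub>A\<^sub>C s' \<Longrightarrow> t =\<^sub>A\<^sub>C t' \<Longrightarrow> s \<otimes> t =\<^sub>A\<^sub>C s' \<otimes> t'"
  by (rule eq_AC_trans[OF eq_AC_context[of s s' "\<lambda>s. s \<otimes> t"] eq_AC_context[of t t' "\<lambda>t. s' \<otimes> t"]])
    (auto intro: ac_step.intros)

text \<open>No AC-step applies to a constant, so the operations below may test for the constants
  and still be well defined modulo AC.\<close>

lemma eq_AC_const:
  assumes "s =\<^sub>A\<^sub>C t"
  shows "s = Zero \<longleftrightarrow> t = Zero" and "s = One \<longleftrightarrow> t = One"
proof -
  have "(s = Zero \<longleftrightarrow> t = Zero) \<and> (s = One \<longleftrightarrow> t = One)"
    using assms unfolding eq_AC_def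
    by (induction rule: rtranclp_induct) (auto elim!: symclpE dest: ac_step_atom)
  then show "s = Zero \<longleftrightarrow> t = Zero" "s = One \<longleftrightarrow> t = One" by auto
qed

section \<open>Simple terms as normal forms\<close>

definition sadd :: "'x trm \<Rightarrow> 'x trm \<Rightarrow> 'x trm" where
  "sadd s t = (if s = Zero then t else if t = Zero then s else s \<oplus> t)"

definition smul :: "'x trm \<Rightarrow> 'x trm \<Rightarrow> 'x trm" where
  "smul s t = (if s = Zero \<or> t = Zero then Zero
     else if s = One then t else if t = One then s else s \<otimes> t)"

lemma sadd_Zero [simp]: "sadd Zero t = t" "sadd t Zero = t"
  by (simp_all add: sadd_def)

lemma sadd_cong: "s =\<^sub>A\<^sub>C s' \<Longrightarrow> t =\<^sub>A\<^sub>C t' \<Longrightarrow> sadd s t =\<^sub>A\<^sub>C sadd s' t'"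
  using eq_AC_const(1)[of s s'] eq_AC_const(1)[of t t'] by (auto simp: sadd_def eq_AC_add_cong)

lemma smul_cong: "s =\<^sub>A\<^sub>C s' \<Longrightarrow> t =\<^sub>A\<^sub>C t' \<Longrightarrow> smul s t =\<^sub>A\<^sub>C smul s' t'"
  using eq_AC_const[of s s'] eq_AC_const[of t t'] by (auto simp: smul_def eq_AC_mul_cong)

lemma sadd_comm: "sadd s t =\<^sub>A\<^sub>C sadd t s"
  by (simp add: sadd_def eq_AC_add_comm)

lemma sadd_assoc: "sadd s (sadd t u) =\<^sub>A\<^sub>C sadd (sadd s t) u"
  by (simp add: sadd_def eq_AC_add_assoc)

lemma smul_assoc: "smul s (smul t u) =\<^sub>A\<^sub>C smul (smul s t) u"
  by (simp add: smul_def eq_AC_mul_assoc)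

lemma sadd_medial: "sadd (sadd a b) (sadd c d) =\<^sub>A\<^sub>C sadd (sadd a c) (sadd b d)"
proof -
  have "sadd (sadd a b) (sadd c d) =\<^sub>A\<^sub>C sadd a (sadd b (sadd c d))"
    by (rule eq_AC_sym[OF sadd_assoc])
  also have "\<dots> =\<^sub>A\<^sub>C sadd a (sadd (sadd b c) d)"
    by (intro sadd_cong sadd_assoc eq_AC_refl)
  also have "\<dots> =\<^sub>A\<^sub>C sadd a (sadd (sadd c b) d)"
    by (intro sadd_cong sadd_comm eq_AC_refl)
  also have "\<dots> =\<^sub>A\<^sub>C sadd a (sadd c (sadd b d))"
    by (intro sadd_cong eq_AC_sym[OF sadd_assoc] eq_AC_refl)
  also have "\<dots> =\<^sub>A\<^sub>C sadd (sadd a c) (sadd b d)"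
    by (rule sadd_assoc)
  finally show ?thesis .
qed

fun simplify :: "'x trm \<Rightarrow> 'x trm" where
  "simplify (s \<oplus> t) = sadd (simplify s) (simplify t)"
| "simplify (s \<otimes> t) = smul (simplify s) (simplify t)"
| "simplify t = t"

lemma simplify_simple: "simple t \<Longrightarrow> simplify t = t"
  by (induction t) (auto simp: simple_Add simple_Mul sadd_def smul_def)

lemma simplify_E: "(s, t) \<in> E X \<Longrightarrow> simplify s =\<^sub>A\<^sub>C simplify t"
  unfolding E_def
  by (auto simp: sadd_assoc sadd_comm smul_assoc) (simp_all add: smul_def)

text \<open>The operations \<open>sadd\<close> and \<open>smul\<close> respect AC and satisfy the axioms up to AC, so the
  terms with AC-equal values under \<open>simplify\<close> form a congruence that contains the axioms.\<close>

lemma eq_E_imp_simplify_eq_AC: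
  assumes "(s, t) \<in> eq_E X"
  shows "simplify s =\<^sub>A\<^sub>C simplify t"
proof (rule smallest_congruence_least[where P = "E X" and X = X and Q = "\<lambda>s t. simplify s =\<^sub>A\<^sub>C simplify t"])
  show "equivp (\<lambda>s t. simplify s =\<^sub>A\<^sub>C simplify t)"
    by (rule equivpI) (auto simp: reflp_def symp_def transp_def intro: eq_AC_sym eq_AC_trans)
  show "s \<in> T X \<and> t \<in> T X \<and> simplify s =\<^sub>A\<^sub>C simplify t" if "(s, t) \<in> E X" for s t
    using E_id_rd_subset_T[of s t X] simplify_E[OF that] that
    by (auto simp: E_id_rd_def E_rd_def)
  show "(s, t) \<in> smallest_congruence X (E X)" using assms by (simp add: eq_E_def)
qed (auto intro: sadd_cong smul_cong)

section \<open>Terms acting on multisets of trees\<close>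

text \<open>\<open>Node x A\<close> stands for the product of \<open>x\<close> with the sum of the trees in \<open>A\<close>. Since
  a product distributes over a sum on its left only, the multiset \<open>A\<close> stays below \<open>x\<close>.\<close>

datatype 'x tree = Unit | Node 'x "'x tree multiset"

text \<open>The operation \<open>j\<close> interprets the sum: it will be the sum of multisets or their union.\<close>

fun act :: "('x tree multiset \<Rightarrow> 'x tree multiset \<Rightarrow> 'x tree multiset) \<Rightarrow>
    'x trm \<Rightarrow> 'x tree multiset \<Rightarrow> 'x tree multiset" where
  "act j Zero A = {#}"
| "act j One A = A"
| "act j (Var x) A = (if A = {#} then {#} else {#Node x A#})"
| "act j (s \<oplus> t) A = j (act j s A) (act j t A)"
| "act j (s \<otimes> t) A = act j s (act j t A)"

lemma act_empty: "j {#} {#} = {#} \<Longrightarrow> act j t {#} = {#}"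
  by (induction t) auto

lemma act_E_rd:
  assumes "comm_monoid j {#}" "(s, t) \<in> E_rd X"
  shows "act j s = act j t"
proof -
  interpret comm_monoid j "{#}" by fact
  show ?thesis
    using assms(2) by (auto simp: E_rd_def E_def fun_eq_iff assoc commute left_commute act_empty)
qed

text \<open>Sums act pointwise and products by composition, so equality of actions is a congruence.\<close>

lemma smallest_congruence_act:
  assumes "\<And>s t. (s, t) \<in> P \<Longrightarrow> s \<in> T X \<and> t \<in> T X \<and> act j s = act j t"
    and "(s, t) \<in> smallest_congruence X P"
  shows "act j s = act j t"
proof (rule smallest_congruence_least[where P = P and X = X and Q = "\<lambda>s t. act j s = act j t"])
  show "equivp (\<lambda>s t. act j s = act j t)"
    by (rule equivpI) (auto simp: reflp_def symp_def transp_def)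
qed (use assms in \<open>auto simp: fun_eq_iff\<close>)

lemma eq_E_rd_imp_act_plus_eq:
  assumes "(s, t) \<in> eq_E_rd X"
  shows "act (+) s = act (+) t"
  using assms unfolding eq_E_rd_def
proof (rule smallest_congruence_act[rotated])
  have "comm_monoid (+) ({#} :: 'a tree multiset)" by unfold_locales (auto simp: ac_simps)
  then show "s \<in> T X \<and> t \<in> T X \<and> act (+) s = act (+) t" if "(s, t) \<in> E_rd X" for s t
    using E_id_rd_subset_T[of s t X] act_E_rd[OF _ that] that by (auto simp: E_id_rd_def)
qed

lemma eq_E_id_rd_imp_act_union_eq:
  assumes "(s, t) \<in> eq_E_id_rd X"
  shows "act (\<union>#) s = act (\<union>#) t"
  using assms unfolding eq_E_id_rd_def
proof (rule smallest_congruence_act[rotated])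
  have "comm_monoid (\<union>#) ({#} :: 'a tree multiset)"
    by unfold_locales (auto simp: multiset_eq_iff)
  then show "s \<in> T X \<and> t \<in> T X \<and> act (\<union>#) s = act (\<union>#) t" if "(s, t) \<in> E_id_rd X" for s t
    using E_id_rd_subset_T[OF that] act_E_rd[of "(\<union>#)" s t X] that
    by (auto simp: E_id_rd_def fun_eq_iff)
qed

lemma act_monomial_indep: "s \<in> monomial_terms X \<Longrightarrow> act j s A = act j' s A"
  by (induction arbitrary: A rule: monomial_terms.induct) auto

lemma act_monomial_singleton:
  assumes "s \<in> monomial_terms X" "A \<noteq> {#}"
  shows "\<exists>n. act j s A = {#n#}"
  using assms
proof (induction arbitrary: A)
  case (2 s t)
  then show ?case by (metis act.simps(5) add_mset_not_empty)
qed auto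

section \<open>Reading a term off a multiset of trees\<close>

text \<open>\<open>reads A t\<close>: \<open>t\<close> is a term denoted by the multiset \<open>A\<close>. The relation is not functional,
  as the elements of \<open>A\<close> may be added in any order and with any parentheses. The use of
  \<open>sadd\<close> and \<open>smul\<close> makes empty parts of a multiset, and nodes \<open>Node x {#Unit#}\<close>, no special
  cases.\<close>

inductive reads :: "'x tree multiset \<Rightarrow> 'x trm \<Rightarrow> bool" where
  zero: "reads {#} Zero"
| unit: "reads {#Unit#} One"
| node: "reads A t \<Longrightarrow> A \<noteq> {#} \<Longrightarrow> reads {#Node x A#} (smul (Var x) t)"
| add: "reads A s \<Longrightarrow> reads B t \<Longrightarrow> reads (A + B) (sadd s t)"

lemma reads_empty: "reads A t \<Longrightarrow> A = {#} \<Longrightarrow> t = Zero"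
  by (induction rule: reads.induct) auto

lemma reads_unit: "reads A t \<Longrightarrow> A = {#Unit#} \<Longrightarrow> t = One"
  by (induction rule: reads.induct) (auto simp: union_is_single dest: reads_empty)

lemma reads_node:
  "reads A t \<Longrightarrow> A = {#Node x B#} \<Longrightarrow> \<exists>u. reads B u \<and> t = smul (Var x) u"
  by (induction rule: reads.induct) (auto simp: union_is_single dest: reads_empty)

text \<open>Two partitions of a multiset into two parts have a common refinement; it is generated by
  choosing the overlap of \<open>A\<close> and \<open>C\<close> as large as possible.\<close>

lemma multiset_sum_refinement:
  assumes "A + B = C + (D :: 'a multiset)"
  obtains K L M N where "A = K + L" "B = M + N" "C = K + M" "D = L + N"
proof
  have count: "count A x + count B x = count C x + count D x" for x
    using assms by (metis count_union)
  show "A = A \<inter># C + (A - C)" "C = A \<inter># C + (C - A)"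
    by (auto simp: multiset_eq_iff)
  show "B = (C - A) + (B - (C - A))"
  proof (rule multiset_eqI)
    show "count B x = count ((C - A) + (B - (C - A))) x" for x using count[of x] by simp
  qed
  show "D = (A - C) + (B - (C - A))"
  proof (rule multiset_eqI)
    show "count D x = count ((A - C) + (B - (C - A))) x" for x using count[of x] by simp
  qed
qed

text \<open>A term read off \<open>A + B\<close> can be regrouped such that the summands from \<open>A\<close> come first:
  a common refinement of two decompositions of a multiset reduces this to the medial law.\<close>

lemma reads_split:
  assumes "reads C t" "C = A + B"
  shows "\<exists>a b. reads A a \<and> reads B b \<and> t =\<^sub>A\<^sub>C sadd a b"
  using assms
proof (induction arbitrary: A B)
  case (add C s D t)
  obtain K L M N where KLMN: "C = K + L" "D = M + N" "A = K + M" "B = L + N"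
    using add.prems by (rule multiset_sum_refinement)
  obtain k l where kl: "reads K k" "reads L l" "s =\<^sub>A\<^sub>C sadd k l"
    using add.IH(1)[OF KLMN(1)] by blast
  obtain m n where mn: "reads M m" "reads N n" "t =\<^sub>A\<^sub>C sadd m n"
    using add.IH(2)[OF KLMN(2)] by blast
  have "sadd s t =\<^sub>A\<^sub>C sadd (sadd k l) (sadd m n)" using kl(3) mn(3) by (rule sadd_cong)
  also have "\<dots> =\<^sub>A\<^sub>C sadd (sadd k m) (sadd l n)" by (rule sadd_medial)
  finally show ?case using KLMN(3,4) kl(1,2) mn(1,2) by (blast intro: reads.add)
next
  case zero
  then show ?case using reads.zero by force
next
  case unit
  then have "A = {#Unit#} \<and> B = {#} \<or> A = {#} \<and> B = {#Unit#}"
    by (metis union_is_single)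
  then show ?case using reads.zero reads.unit by force
next
  case (node C t x)
  then have "A = {#Node x C#} \<and> B = {#} \<or> A = {#} \<and> B = {#Node x C#}"
    by (metis union_is_single)
  moreover have "reads {#Node x C#} (smul (Var x) t)"
    using node.hyps by (rule reads.node)
  ultimately show ?case using reads.zero by force
qed

lemma reads_unique: "reads A s \<Longrightarrow> reads A t \<Longrightarrow> s =\<^sub>A\<^sub>C t"
proof (induction arbitrary: t rule: reads.induct)
  case zero
  then show ?case using reads_empty by fastforce
next
  case unit
  then show ?case using reads_unit by fastforce
next
  case (node A s x)
  then show ?case by (metis reads_node smul_cong eq_AC_refl)
next
  case (add A s B s')
  then obtain a b where "reads A a" "reads B b" "t =\<^sub>A\<^sub>C sadd a b"
    using reads_split by blast
  with add.IH show ?case by (meson eq_AC_sym eq_AC_trans sadd_cong)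
qed

text \<open>The restriction to nonempty \<open>A\<close> guarantees that the nodes built by the action satisfy the
  side condition of the rule \<open>node\<close>.\<close>

lemma reads_act_monomial:
  assumes "s \<in> monomial_terms X" "reads A t" "A \<noteq> {#}"
  shows "\<exists>u. reads (act (+) s A) u \<and> u =\<^sub>A\<^sub>C smul s t"
  using assms
proof (induction arbitrary: A t)
  case (1 x)
  then show ?case by (auto intro: reads.node)
next
  case (2 r s)
  obtain u where u: "reads (act (+) s A) u" "u =\<^sub>A\<^sub>C smul s t"
    using "2.IH"(2) "2.prems" by blast
  have "act (+) s A \<noteq> {#}"
    using act_monomial_singleton[OF "2.hyps"(2) "2.prems"(2)] by (metis add_mset_not_empty)
  then obtain v where v: "reads (act (+) r (act (+) s A)) v" "v =\<^sub>A\<^sub>C smul r u"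
    using "2.IH"(1) u(1) by blast
  note v(2)
  also have "smul r u =\<^sub>A\<^sub>C smul r (smul s t)" using u(2) by (intro smul_cong eq_AC_refl)
  also have "\<dots> =\<^sub>A\<^sub>C smul (smul r s) t" by (rule smul_assoc)
  also have "smul r s = r \<otimes> s"
    using "2.hyps" monomial_terms_subset_ST[of X] by (auto simp: smul_def)
  finally show ?case using v(1) by auto
qed

text \<open>In a product that is a polynomial term the left factor is a monomial, so the action never
  distributes anything and a sum below a variable stays there. Reading
  the result back therefore changes the order and the parentheses only.\<close>

lemma reads_act_PT:
  assumes "t \<in> PT X"
  shows "\<exists>u. reads (act (+) t {#Unit#}) u \<and> u =\<^sub>A\<^sub>C t"
  using assms
proof induction
  case zero
  then show ?case using reads.zero by force
next
  case one
  then show ?case using reads.unit by force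
next
  case (monomial s)
  then have "smul s One = s" using monomial_terms_subset_ST[of X] by (auto simp: smul_def)
  then show ?case using reads_act_monomial[OF monomial reads.unit] by simp
next
  case (add s t)
  then have "sadd s t = s \<oplus> t" by (simp add: sadd_def)
  then show ?case using add.IH by (metis act.simps(4) reads.add sadd_cong)
next
  case (mul s t)
  obtain u where u: "reads (act (+) t {#Unit#}) u" "u =\<^sub>A\<^sub>C t" using mul.IH by blast
  have "act (+) t {#Unit#} \<noteq> {#}"
    using u mul.hyps(3) reads_empty eq_AC_const(1) by blast
  then obtain v where "reads (act (+) (s \<otimes> t) {#Unit#}) v" "v =\<^sub>A\<^sub>C smul s u"
    using reads_act_monomial[OF mul.hyps(1) u(1)] by auto
  moreover have "smul s u =\<^sub>A\<^sub>C smul s t" using u(2) by (intro smul_cong eq_AC_refl)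
  moreover have "smul s t = s \<otimes> t"
    using mul.hyps monomial_terms_subset_ST[of X] by (auto simp: smul_def)
  ultimately show ?case by (metis eq_AC_trans)
qed

lemma PT_act_plus_inj:
  assumes "s \<in> PT X" "t \<in> PT X" "act (+) s {#Unit#} = act (+) t {#Unit#}"
  shows "s =\<^sub>A\<^sub>C t"
  using assms reads_act_PT reads_unique by (metis eq_AC_sym eq_AC_trans)

section \<open>Terms without repeated summands\<close>

lemma PT_Add_D: "s \<oplus> t \<in> PT X \<Longrightarrow> s \<in> PT X \<and> t \<in> PT X"
  by (erule PT.cases) (auto elim: monomial_terms.cases)

lemma PT_Mul_D: "s \<otimes> t \<in> PT X \<Longrightarrow> s \<in> monomial_terms X \<and> t \<in> PT X"
  by (erule PT.cases) (auto elim: monomial_terms.cases intro: PT.monomial)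

lemma bracketing_PT: "bracketing ts t \<Longrightarrow> t \<in> PT X \<Longrightarrow> set ts \<subseteq> PT X"
  by (induction rule: bracketing.induct) (auto dest: PT_Add_D)

lemma act_plus_summand_singleton:
  assumes "t \<in> PT X" "t \<in> product_terms X \<union> Var ` X \<union> {One}"
  shows "\<exists>n. act (+) t {#Unit#} = {#n#}"
proof (cases t)
  case (Mul r s)
  have s: "r \<in> monomial_terms X" "s \<in> PT X" using PT_Mul_D assms(1) Mul by auto
  have "s \<noteq> Zero" using assms(2) Mul by (auto simp: product_terms_def)
  then have "act (+) s {#Unit#} \<noteq> {#}"
    using reads_act_PT[OF s(2)] reads_empty eq_AC_const(1) by blast
  then show ?thesis using act_monomial_singleton[OF s(1)] Mul by simp
qed (use assms(2) in \<open>auto simp: product_terms_def\<close>)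

lemma union_mset_eq_plus:
  assumes "set_mset A \<inter> set_mset B = {}"
  shows "A \<union># B = A + B"
proof (rule multiset_eqI)
  fix x
  have "count A x = 0 \<or> count B x = 0"
    using assms by (meson disjoint_iff not_in_iff)
  then show "count (A \<union># B) x = count (A + B) x" by auto
qed

text \<open>The second conclusion serves the induction: it shows that pairwise disjointness of the
  results for the listed summands passes to the two halves of any bracketing.\<close>

lemma act_union_bracketing:
  assumes "bracketing ts t"
    and "\<forall>u \<in> set ts. act (\<union>#) u A = act (+) u A"
    and "sorted_wrt (\<lambda>u v. set_mset (act (+) u A) \<inter> set_mset (act (+) v A) = {}) ts"
  shows "act (\<union>#) t A = act (+) t A \<and>
    set_mset (act (+) t A) = (\<Union>u \<in> set ts. set_mset (act (+) u A))"
  using assms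
proof induction
  case (add ss s ts t)
  let ?D = "\<lambda>u v. set_mset (act (+) u A) \<inter> set_mset (act (+) v A) = {}"
  have sorted: "sorted_wrt ?D ss" "sorted_wrt ?D ts" "\<forall>u \<in> set ss. \<forall>v \<in> set ts. ?D u v"
    using add.prems(2) by (auto simp: sorted_wrt_append)
  have s: "act (\<union>#) s A = act (+) s A"
    "set_mset (act (+) s A) = (\<Union>u \<in> set ss. set_mset (act (+) u A))"
    using add.IH(1) add.prems(1) sorted(1) by auto
  have t: "act (\<union>#) t A = act (+) t A"
    "set_mset (act (+) t A) = (\<Union>u \<in> set ts. set_mset (act (+) u A))"
    using add.IH(2) add.prems(1) sorted(2) by auto
  have "?D s t" using sorted(3) unfolding s(2) t(2) by blast
  then show ?case using s t by (simp add: union_mset_eq_plus)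
qed simp

text \<open>Each summand sends the unit multiset to a single tree, and by \<open>PT_act_plus_inj\<close> these trees
  differ for summands that are not AC-equal; so all unions that occur are disjoint.\<close>

lemma act_union_eq_act_plus:
  assumes "t \<in> ST_id X" "t \<in> PT X"
  shows "act (\<union>#) t {#Unit#} = act (+) t {#Unit#}"
  using assms
proof induction
  case (monomial s)
  show ?case using monomial.hyps by (rule act_monomial_indep)
next
  case (mul s t)
  then show ?case
    using PT_Mul_D[OF mul.prems] act_monomial_indep[of s X "(\<union>#)" _ "(+)"] by simp
next
  case (sum t ts)
  have ts: "bracketing ts t" "set ts \<subseteq> product_terms X \<union> Var ` X \<union> {One}"
    using sum.hyps(1) by (auto simp: sum_product_decomposition_def)
  have PT: "set ts \<subseteq> PT X" using ts(1) sum.prems by (rule bracketing_PT)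
  have "set_mset (act (+) (ts ! i) {#Unit#}) \<inter> set_mset (act (+) (ts ! j) {#Unit#}) = {}"
    if "i < j" "j < length ts" for i j
  proof -
    have mem: "ts ! i \<in> set ts" "ts ! j \<in> set ts" using that by auto
    obtain m n where "act (+) (ts ! i) {#Unit#} = {#m#}" "act (+) (ts ! j) {#Unit#} = {#n#}"
      using act_plus_summand_singleton mem PT ts(2) by (meson subsetD)
    moreover have "act (+) (ts ! i) {#Unit#} \<noteq> act (+) (ts ! j) {#Unit#}"
      using PT_act_plus_inj[of "ts ! i" X "ts ! j"] sum.hyps that mem PT by blast
    ultimately show ?thesis by auto
  qed
  then have "sorted_wrt (\<lambda>u v. set_mset (act (+) u {#Unit#}) \<inter> set_mset (act (+) v {#Unit#}) = {}) ts"
    by (simp add: sorted_wrt_iff_nth_less)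
  moreover have "\<forall>u \<in> set ts. act (\<union>#) u {#Unit#} = act (+) u {#Unit#}"
    using sum.IH PT by blast
  ultimately show ?case
    using act_union_bracketing[OF ts(1)] by blast
qed simp_all

section \<open>Uniqueness of normal forms\<close>

theorem theorem5p4:
  fixes X :: "'x set"
  assumes "X \<noteq> {}"
  shows
    "(\<forall>t \<in> ST X. \<forall>t' \<in> ST X. (t, t') \<in> eq_E X \<longrightarrow> t =\<^sub>A\<^sub>C t') \<and>
     (\<forall>t \<in> PT X. \<forall>t' \<in> PT X. (t, t') \<in> eq_E_rd X \<longrightarrow> t =\<^sub>A\<^sub>C t') \<and>
     (\<forall>t \<in> PT_id X. \<forall>t' \<in> PT_id X. (t, t') \<in> eq_E_id_rd X \<longrightarrow> t =\<^sub>A\<^sub>C t')"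
proof (intro conjI ballI impI)
  fix t t' assume "t \<in> ST X" "t' \<in> ST X" "(t, t') \<in> eq_E X"
  then show "t =\<^sub>A\<^sub>C t'"
    using eq_E_imp_simplify_eq_AC[of t t' X] by (simp add: ST_def simplify_simple)
next
  fix t t' assume "t \<in> PT X" "t' \<in> PT X" "(t, t') \<in> eq_E_rd X"
  then show "t =\<^sub>A\<^sub>C t'"
    using PT_act_plus_inj eq_E_rd_imp_act_plus_eq by metis
next
  fix t t' assume "t \<in> PT_id X" "t' \<in> PT_id X" "(t, t') \<in> eq_E_id_rd X"
  moreover from this have "act (\<union>#) t {#Unit#} = act (\<union>#) t' {#Unit#}"
    using eq_E_id_rd_imp_act_union_eq by metis
  ultimately show "t =\<^sub>A\<^sub>C t'"
    using PT_act_plus_inj[of t X t'] act_union_eq_act_plus[of t X] act_union_eq_act_plus[of t' X]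
    by (simp add: PT_id_def)
qed

end
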